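(* Let $f(z)=\sum_{n=0}^{\infty} a_n z^n\in\mathcal{B}$, let $\omega\in\mathcal{B}_m$ for some $m\in\mathbb{N}$, let $p\in(0,2]$, and let $\varphi=\{\varphi_n(r)\}_{n=0}^{\infty}\in\mathcal{F}$. For $r\in[0,1)$ define $$\Psi_2(r)=\frac p2\varphi_0(r)-\Phi_1(r)-\frac{r^m}{1-r^m},$$ and let $R_2:=R_2(m,p)$ be the minimal positive root of the equation $\Psi_2(r)=0$. If $\Psi_2(r)\ge0$ for $0\le r\le R_2$, then, for $z\in\mathbb{D}$ with $|z|=r$, $$B_f(z):=|a_0|^p\varphi_0(r)+B_1(f,\varphi,r)+A(f_0,\varphi,r)+|f(\omega(z))-a_0|\le\varphi_0(r)\quad\text{for } r\le R_2.$$ Moreover, in the case when $\Psi_2(r)<0$ in some interval $(R_2,R_2+\varepsilon)$ with $\varepsilon>0$, the number $R_2$ cannot be improved.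
   Context: $\mathbb{D}=\{z\in\mathbb{C}:|z|<1\}$ and $\mathbb{N}=\{1,2,\ldots\}$. $\mathcal{B}$ is the set of analytic functions $f$ on $\mathbb{D}$ with $\sup_{z\in\mathbb{D}}|f(z)|\le 1$. For $m\in\mathbb{N}$, $\mathcal{B}_m=\{\omega\in\mathcal{B}:\omega(0)=\cdots=\omega^{(m-1)}(0)=0,\ \omega^{(m)}(0)\ne0\}$. $\mathcal{F}$ is the set of all sequences $\varphi=\{\varphi_n(r)\}_{n=0}^\infty$ of nonnegative continuous functions on $[0,1)$ such that $\sum_{n=0}^\infty\varphi_n(r)$ converges locally uniformly on $[0,1)$. For $\varphi\in\mathcal{F}$ put $\Phi_N(r)=\sum_{n=N}^\infty\varphi_n(r)$. For $f(z)=\sum_{n=0}^\infty a_nz^n\in\mathcal{B}$ put $f_0(z)=f(z)-f(0)$, $$B_1(f,\varphi,r)=\sum_{n=1}^\infty|a_n|\varphi_n(r),\qquad A(f_0,\varphi,r)=\sum_{n=1}^\infty|a_n|^2\left[\frac{\varphi_{2n}(r)}{1+|a_0|}+\Phi_{2n+1}(r)\right].$$ "The number $R_2$ cannot be improved" means that, for the given $m,p,\varphi$, $R_2$ cannot be replaced by a larger number: for every $R'\in(R_2,1]$ there exist $f\in\mathcal{B}$, $\omega\in\mathcal{B}_m$ and $z$ with $|z|=r<R'$ such that $B_f(z)>\varphi_0(r)$. *)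

theory Defs
  imports "HOL-Complex_Analysis.Complex_Analysis"
begin

abbreviation unit_disc :: "complex set" where
  "unit_disc \<equiv> ball 0 1"

text \<open>The condition on the supremum is stated pointwise, since \<open>Sup\<close> on the reals is
  unspecified for unbounded sets.\<close>

definition bounded_class :: "(complex \<Rightarrow> complex) set" where
  "bounded_class = {f. f analytic_on unit_disc \<and> (\<forall>z\<in>unit_disc. norm (f z) \<le> 1)}"

definition schwarz_class :: "nat \<Rightarrow> (complex \<Rightarrow> complex) set" where
  "schwarz_class m =
     {\<omega>\<in>bounded_class. (\<forall>k<m. (deriv ^^ k) \<omega> 0 = 0) \<and> (deriv ^^ m) \<omega> 0 \<noteq> 0}"

definition taylor_coeff :: "(complex \<Rightarrow> complex) \<Rightarrow> nat \<Rightarrow> complex" where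
  "taylor_coeff f n = fps_nth (fps_expansion f 0) n"

definition locally_uniformly_convergent_on ::
    "real set \<Rightarrow> (nat \<Rightarrow> real \<Rightarrow> real) \<Rightarrow> bool" where
  "locally_uniformly_convergent_on S F \<longleftrightarrow>
     (\<forall>x\<in>S. \<exists>U. open U \<and> x \<in> U \<and> uniformly_convergent_on (U \<inter> S) F)"

definition weight_class :: "(nat \<Rightarrow> real \<Rightarrow> real) set" where
  "weight_class =
     {\<phi>. (\<forall>n. continuous_on {0..<1} (\<phi> n)) \<and>
         (\<forall>n. \<forall>r\<in>{0..<1}. 0 \<le> \<phi> n r) \<and>
         locally_uniformly_convergent_on {0..<1} (\<lambda>N r. \<Sum>n<N. \<phi> n r)}"

definition tail_sum :: "(nat \<Rightarrow> real \<Rightarrow> real) \<Rightarrow> nat \<Rightarrow> real \<Rightarrow> real" where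
  "tail_sum \<phi> N r = (\<Sum>n. \<phi> (N + n) r)"

text \<open>For \<open>f\<close> in \<open>bounded_class\<close>, \<open>\<phi>\<close> in \<open>weight_class\<close> and \<open>0 \<le> r < 1\<close> the two series
  below always converge, because \<open>\<bar>a\<^sub>n\<bar> \<le> 1\<close> and \<open>\<Sum>\<bar>a\<^sub>n\<bar>\<^sup>2 \<le> 1\<close>. Both run over \<open>n \<ge> 1\<close>.\<close>

definition B1 :: "(complex \<Rightarrow> complex) \<Rightarrow> (nat \<Rightarrow> real \<Rightarrow> real) \<Rightarrow> real \<Rightarrow> real" where
  "B1 f \<phi> r = (\<Sum>n. norm (taylor_coeff f (Suc n)) * \<phi> (Suc n) r)"

text \<open>\<open>A0 f\<close> stands for the quantity \<open>A(f\<^sub>0, \<phi>, r)\<close>, where \<open>f\<^sub>0 = f - f(0)\<close>: it depends on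
  the coefficients \<open>a\<^sub>n\<close>, \<open>n \<ge> 1\<close>, which \<open>f\<close> and \<open>f\<^sub>0\<close> share, and on \<open>a\<^sub>0 = f(0)\<close>.\<close>

definition A0 :: "(complex \<Rightarrow> complex) \<Rightarrow> (nat \<Rightarrow> real \<Rightarrow> real) \<Rightarrow> real \<Rightarrow> real" where
  "A0 f \<phi> r =
     (\<Sum>n. (norm (taylor_coeff f (Suc n)))\<^sup>2 *
        (\<phi> (2 * Suc n) r / (1 + norm (taylor_coeff f 0)) + tail_sum \<phi> (2 * Suc n + 1) r))"

definition bohr_sum ::
    "real \<Rightarrow> (nat \<Rightarrow> real \<Rightarrow> real) \<Rightarrow> (complex \<Rightarrow> complex) \<Rightarrow> (complex \<Rightarrow> complex) \<Rightarrow> complex \<Rightarrow> real"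
  where
  "bohr_sum p \<phi> \<omega> f z =
     norm (taylor_coeff f 0) powr p * \<phi> 0 (norm z) + B1 f \<phi> (norm z) + A0 f \<phi> (norm z)
     + norm (f (\<omega> z) - taylor_coeff f 0)"

definition Psi2 :: "nat \<Rightarrow> real \<Rightarrow> (nat \<Rightarrow> real \<Rightarrow> real) \<Rightarrow> real \<Rightarrow> real" where
  "Psi2 m p \<phi> r = p / 2 * \<phi> 0 r - tail_sum \<phi> 1 r - r ^ m / (1 - r ^ m)"

text \<open>Roots are sought in \<open>(0, 1)\<close>, since the functions concerned live on \<open>[0, 1)\<close>.\<close>

definition minimal_positive_root :: "(real \<Rightarrow> real) \<Rightarrow> real \<Rightarrow> bool" where
  "minimal_positive_root g R \<longleftrightarrow>
     0 < R \<and> R < 1 \<and> g R = 0 \<and> (\<forall>r. 0 < r \<and> r < R \<longrightarrow> g r \<noteq> 0)"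

end

theory Submission
  imports Defs "HOL-Real_Asymp.Real_Asymp"
begin

text \<open>Let \<open>a = |a\<^sub>0|\<close>. Since multiplication by \<open>f\<close> is a contraction of the Hardy space, the lower
  triangular Toeplitz matrices of the coefficients of \<open>f\<close> are contractions, and testing them on suitable
  vectors yields Carlson's inequalities
  \<open>|a\<^sub>2\<^sub>n\<^sub>+\<^sub>1| \<le> 1 - |a\<^sub>0|\<^sup>2 - \<dots> - |a\<^sub>n|\<^sup>2\<close> and
  \<open>|a\<^sub>2\<^sub>n| \<le> 1 - |a\<^sub>0|\<^sup>2 - \<dots> - |a\<^sub>n\<^sub>-\<^sub>1|\<^sup>2 - |a\<^sub>n|\<^sup>2 / (1 + a)\<close>.
  Summed against the weights they give \<open>B\<^sub>1 + A \<le> (1 - a\<^sup>2) \<Phi>\<^sub>1\<close>; and from \<open>|a\<^sub>n| \<le> 1 - a\<^sup>2\<close>,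
  \<open>|\<omega>(z)| \<le> r\<^sup>m\<close> one gets \<open>|f(\<omega>(z)) - a\<^sub>0| \<le> (1 - a\<^sup>2) r\<^sup>m / (1 - r\<^sup>m)\<close>. The bound follows from
  \<open>1 - a\<^sup>p \<ge> (p/2)(1 - a\<^sup>2)\<close>. All these estimates become sharp to first order in \<open>1 - a\<close> for
  \<open>f(z) = (z - a) / (1 - az)\<close>, \<open>\<omega>(z) = z\<^sup>m\<close>, \<open>z = r\<close> as \<open>a \<rightarrow> 1\<close>, so \<open>\<Psi>\<^sub>2(r) < 0\<close> forces a violation.\<close>

section \<open>Taylor coefficients as integrals over circles\<close>

text \<open>Parametrised over \<open>[0, 1]\<close> to match \<open>circlepath\<close>, so that
  means over the circle are plain integrals.\<close>

definition circ :: "real \<Rightarrow> complex" where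
  "circ t = exp (2 * of_real pi * \<i> * of_real t)"

lemma norm_circ [simp]: "norm (circ t) = 1"
  by (simp add: circ_def)

lemma circ_cnj [simp]: "circ t * cnj (circ t) = 1"
  by (metis complex_norm_square norm_circ of_real_1 one_power2)

lemma has_fps_expansion_disc:
  assumes "f holomorphic_on ball 0 1"
  shows "f has_fps_expansion fps_expansion f 0"
  using assms by (intro has_fps_expansion_fps_expansion[of "ball 0 1"]) auto

text \<open>Cauchy's formula for the derivatives at 0 read as a Fourier coefficient: on the unit
  circle conjugation is inversion, and the factor \<open>2 * pi * \<i>\<close> from the derivative
  of the path cancels.\<close>

lemma has_integral_taylor_coeff_0:
  fixes \<rho> :: real
  assumes "f holomorphic_on ball 0 1" "0 < \<rho>" "\<rho> < 1"
  shows "((\<lambda>t. f (\<rho> * circ t) * cnj (circ t) ^ n) has_integral taylor_coeff f n * of_real \<rho> ^ n) {0..1}"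
proof -
  have sub: "cball 0 \<rho> \<subseteq> ball (0::complex) 1" using assms by auto
  have "((\<lambda>u. f u / (u - 0) ^ Suc n) has_contour_integral
      (2 * pi * \<i> / fact n * (deriv ^^ n) f 0)) (circlepath 0 \<rho>)"
  proof (rule Cauchy_has_contour_integral_higher_derivative_circlepath)
    show "continuous_on (cball 0 \<rho>) f"
      using assms sub holomorphic_on_imp_continuous_on continuous_on_subset by blast
    show "f holomorphic_on ball 0 \<rho>"
      using assms sub ball_subset_cball holomorphic_on_subset by (metis subset_trans)
    show "(0::complex) \<in> ball 0 \<rho>" using assms by simp
  qed
  then have *: "((\<lambda>x. f (circlepath 0 \<rho> x) / (circlepath 0 \<rho> x) ^ Suc n
        * vector_derivative (circlepath 0 \<rho>) (at x)) has_integral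
      (2 * pi * \<i> * taylor_coeff f n)) {0..1}"
    by (simp add: has_contour_integral taylor_coeff_def fps_expansion_def mult_ac)
  have eq: "f (\<rho> * circ t) * cnj (circ t) ^ n =
      of_real \<rho> ^ n / (2 * pi * \<i>) * (f (circlepath 0 \<rho> t) / (circlepath 0 \<rho> t) ^ Suc n
        * vector_derivative (circlepath 0 \<rho>) (at t))" for t
  proof -
    have c: "circlepath 0 \<rho> t = \<rho> * circ t" "circ t \<noteq> 0"
      "vector_derivative (circlepath 0 \<rho>) (at t) = 2 * pi * \<i> * (\<rho> * circ t)"
      unfolding vector_derivative_circlepath by (simp_all add: circlepath circ_def)
    have d: "cnj (circ t) ^ n = 1 / circ t ^ n"
      using c(2) by (simp add: field_simps flip: power_mult_distrib)
    show ?thesis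
      unfolding c d using assms c(2) by (simp add: field_simps power_mult_distrib)
  qed
  show ?thesis
    unfolding eq using has_integral_mult_right[OF *, of "of_real \<rho> ^ n / (2 * pi * \<i>)"]
    by (simp add: field_simps)
qed

text \<open>Multiplying by \<open>z ^ j\<close> shifts the coefficients by \<open>j\<close>. The
  values are the entries, in row \<open>i\<close> and column \<open>j\<close>, of the lower
  triangular Toeplitz matrix of the dilated function.\<close>

lemma has_integral_taylor_coeff:
  fixes \<rho> :: real
  assumes "f holomorphic_on ball 0 1" "0 < \<rho>" "\<rho> < 1"
  shows "((\<lambda>t. f (\<rho> * circ t) * circ t ^ j * cnj (circ t) ^ i) has_integral
     (if i < j then 0 else taylor_coeff f (i - j) * of_real \<rho> ^ (i - j))) {0..1}"
proof -
  let ?h = "\<lambda>z. f z * z ^ j"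
  have h: "?h holomorphic_on ball 0 1"
    using assms by (intro holomorphic_intros)
  have "?h has_fps_expansion fps_expansion f 0 * fps_X ^ j"
    by (intro fps_expansion_intros has_fps_expansion_disc assms)
  then have co: "taylor_coeff ?h i = (if i < j then 0 else taylor_coeff f (i - j))"
    by (simp add: taylor_coeff_def fps_expansion_eqI fps_X_power_mult_right_nth)
  have "((\<lambda>t. 1 / of_real \<rho> ^ j * (?h (\<rho> * circ t) * cnj (circ t) ^ i)) has_integral
      1 / of_real \<rho> ^ j * (taylor_coeff ?h i * of_real \<rho> ^ i)) {0..1}"
    by (intro has_integral_mult_right has_integral_taylor_coeff_0 h assms)
  moreover have "1 / of_real \<rho> ^ j * (taylor_coeff ?h i * of_real \<rho> ^ i)
      = (if i < j then 0 else taylor_coeff f (i - j) * of_real \<rho> ^ (i - j))"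
    using assms by (auto simp: co field_simps simp flip: power_add)
  ultimately show ?thesis
    using assms by (simp add: power_mult_distrib mult_ac)
qed

text \<open>The case of the constant function 1; the radius 1/2 is arbitrary, since only the
  coefficient of index 0 survives.\<close>

lemma has_integral_circ_powers:
  "((\<lambda>t. circ t ^ j * cnj (circ t) ^ i) has_integral (if i = j then 1 else 0)) {0..1}"
proof -
  have "taylor_coeff (\<lambda>_. 1) k = (if k = 0 then 1 else 0)" for k
    by (simp add: taylor_coeff_def fps_expansion_eqI[OF has_fps_expansion_1])
  moreover have "(\<lambda>_. 1 :: complex) holomorphic_on ball 0 1"
    by simp
  from has_integral_taylor_coeff[OF this, of "1/2" j i]
  have "((\<lambda>t. circ t ^ j * cnj (circ t) ^ i) has_integral (if i < j then 0 else
      taylor_coeff (\<lambda>_. 1) (i - j) * of_real (1/2) ^ (i - j))) {0..1}"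
    by (simp del: of_real_divide)
  ultimately show ?thesis
    by (cases "i < j"; cases "i = j") (auto simp: of_real_divide)
qed

section \<open>The Toeplitz contraction inequality\<close>

text \<open>The form is the mean over the circle of \<open>f * X * Y\<close>, with trigonometric
  polynomials \<open>X\<close> and \<open>Y\<close> built from \<open>x\<close> and
  \<open>y\<close>. As \<open>f\<close> is bounded by 1, the inequality between geometric and
  arithmetic mean applies under the integral, and Parseval's identity (\<open>energy\<close>)
  evaluates the result.\<close>

lemma Re_toeplitz_scaled_le:
  fixes \<rho> :: real
  assumes "f \<in> bounded_class" "0 < \<rho>" "\<rho> < 1"
  shows "Re (\<Sum>i\<le>N. y i * (\<Sum>j\<le>i. taylor_coeff f (i - j) * of_real \<rho> ^ (i - j) * x j))
    \<le> ((\<Sum>i\<le>N. (norm (x i))\<^sup>2) + (\<Sum>i\<le>N. (norm (y i))\<^sup>2)) / 2"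
proof -
  have hol: "f holomorphic_on ball 0 1" and bd: "\<And>z. norm z < 1 \<Longrightarrow> norm (f z) \<le> 1"
    using assms by (auto simp: bounded_class_def analytic_imp_holomorphic)
  define X Y where "X t = (\<Sum>j\<le>N. x j * circ t ^ j)"
    and "Y t = (\<Sum>i\<le>N. y i * cnj (circ t) ^ i)" for t
  have energy: "((\<lambda>t. (norm (\<Sum>j\<le>N. w j * circ t ^ j))\<^sup>2) has_integral (\<Sum>i\<le>N. (norm (w i))\<^sup>2)) {0..1}"
    for w :: "nat \<Rightarrow> complex"
  proof -
    have "((\<lambda>t. \<Sum>j\<le>N. \<Sum>i\<le>N. w j * cnj (w i) * (circ t ^ j * cnj (circ t) ^ i)) has_integral
        (\<Sum>j\<le>N. \<Sum>i\<le>N. w j * cnj (w i) * (if i = j then 1 else 0))) {0..1}"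
      by (intro has_integral_sum finite_atMost has_integral_mult_right has_integral_circ_powers)
    moreover have "(\<Sum>j\<le>N. \<Sum>i\<le>N. w j * cnj (w i) * (if i = j then 1 else 0))
        = of_real (\<Sum>i\<le>N. (norm (w i))\<^sup>2)"
      by (simp add: if_distrib[of "\<lambda>z. _ * z"] complex_norm_square del: of_real_power cong: if_cong)
    moreover have "(\<Sum>j\<le>N. \<Sum>i\<le>N. w j * cnj (w i) * (circ t ^ j * cnj (circ t) ^ i))
        = of_real ((norm (\<Sum>j\<le>N. w j * circ t ^ j))\<^sup>2)" for t
      by (simp only: complex_norm_square cnj_sum complex_cnj_mult complex_cnj_power sum_product mult_ac)
    ultimately have "((\<lambda>t. complex_of_real ((norm (\<Sum>j\<le>N. w j * circ t ^ j))\<^sup>2)) has_integral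
        of_real (\<Sum>i\<le>N. (norm (w i))\<^sup>2)) {0..1}"
      by simp
    from has_integral_linear[OF this bounded_linear_Re] show ?thesis
      by (simp only: o_def Re_complex_of_real)
  qed
  have X2: "((\<lambda>t. (norm (X t))\<^sup>2) has_integral (\<Sum>i\<le>N. (norm (x i))\<^sup>2)) {0..1}"
    unfolding X_def by (rule energy)
  \<comment> \<open>Conjugation turns the negative powers in \<open>Y t\<close> into positive ones
    without changing the modulus, so \<open>energy\<close> applies.\<close>
  have "norm (Y t) = norm (\<Sum>j\<le>N. cnj (y j) * circ t ^ j)" for t
    by (subst complex_mod_cnj[symmetric]) (simp add: Y_def)
  then have Y2: "((\<lambda>t. (norm (Y t))\<^sup>2) has_integral (\<Sum>i\<le>N. (norm (y i))\<^sup>2)) {0..1}"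
    using energy[of "\<lambda>i. cnj (y i)"] by simp
  have "((\<lambda>t. \<Sum>i\<le>N. \<Sum>j\<le>N. y i * x j * (f (\<rho> * circ t) * circ t ^ j * cnj (circ t) ^ i)) has_integral
      (\<Sum>i\<le>N. \<Sum>j\<le>N. y i * x j * (if i < j then 0 else taylor_coeff f (i - j) * of_real \<rho> ^ (i - j)))) {0..1}"
    by (intro has_integral_sum finite_atMost has_integral_mult_right has_integral_taylor_coeff hol assms)
  moreover have "(\<Sum>i\<le>N. \<Sum>j\<le>N. y i * x j * (f (\<rho> * circ t) * circ t ^ j * cnj (circ t) ^ i))
      = f (\<rho> * circ t) * X t * Y t" for t
    unfolding X_def Y_def sum_distrib_left sum_distrib_right
    by (simp add: mult_ac)
  moreover have "(\<Sum>j\<le>N. y i * x j * (if i < j then 0 else taylor_coeff f (i - j) * of_real \<rho> ^ (i - j)))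
      = y i * (\<Sum>j\<le>i. taylor_coeff f (i - j) * of_real \<rho> ^ (i - j) * x j)" if "i \<le> N" for i
    unfolding sum_distrib_left using that by (intro sum.mono_neutral_cong_right) auto
  ultimately have "((\<lambda>t. f (\<rho> * circ t) * X t * Y t) has_integral
      (\<Sum>i\<le>N. y i * (\<Sum>j\<le>i. taylor_coeff f (i - j) * of_real \<rho> ^ (i - j) * x j))) {0..1}"
    by (auto intro!: sum.cong elim!: has_integral_eq_rhs)
  from has_integral_linear[OF this bounded_linear_Re]
  have "((\<lambda>t. Re (f (\<rho> * circ t) * X t * Y t)) has_integral
      Re (\<Sum>i\<le>N. y i * (\<Sum>j\<le>i. taylor_coeff f (i - j) * of_real \<rho> ^ (i - j) * x j))) {0..1}"
    by (simp only: o_def)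
  moreover have "((\<lambda>t. ((norm (X t))\<^sup>2 + (norm (Y t))\<^sup>2) / 2) has_integral
      ((\<Sum>i\<le>N. (norm (x i))\<^sup>2) + (\<Sum>i\<le>N. (norm (y i))\<^sup>2)) / 2) {0..1}"
    by (intro has_integral_divide has_integral_add X2 Y2)
  moreover have "Re (f (\<rho> * circ t) * X t * Y t) \<le> ((norm (X t))\<^sup>2 + (norm (Y t))\<^sup>2) / 2" for t
  proof -
    have "Re (f (\<rho> * circ t) * X t * Y t) \<le> norm (f (\<rho> * circ t)) * (norm (X t) * norm (Y t))"
      by (metis complex_Re_le_cmod norm_mult mult.assoc)
    also have "\<dots> \<le> 1 * (norm (X t) * norm (Y t))"
      using assms by (intro mult_right_mono bd) (auto simp: norm_mult)
    also have "\<dots> \<le> ((norm (X t))\<^sup>2 + (norm (Y t))\<^sup>2) / 2"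
      using sum_squares_bound[of "norm (X t)" "norm (Y t)"] by simp
    finally show ?thesis .
  qed
  ultimately show ?thesis
    by (rule has_integral_le)
qed

text \<open>Both sums are finite, so the left side is continuous in the radius, which may tend to
  1.\<close>

lemma Re_toeplitz_le:
  assumes "f \<in> bounded_class"
  shows "Re (\<Sum>i\<le>N. y i * (\<Sum>j\<le>i. taylor_coeff f (i - j) * x j))
    \<le> ((\<Sum>i\<le>N. (norm (x i))\<^sup>2) + (\<Sum>i\<le>N. (norm (y i))\<^sup>2)) / 2"
proof (rule tendsto_upperbound)
  have "((\<lambda>\<rho>. Re (\<Sum>i\<le>N. y i * (\<Sum>j\<le>i. taylor_coeff f (i - j) * of_real \<rho> ^ (i - j) * x j)))
      \<longlongrightarrow> Re (\<Sum>i\<le>N. y i * (\<Sum>j\<le>i. taylor_coeff f (i - j) * complex_of_real 1 ^ (i - j) * x j))) (at_left 1)"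
    by (intro tendsto_intros)
  then show "((\<lambda>\<rho>. Re (\<Sum>i\<le>N. y i * (\<Sum>j\<le>i. taylor_coeff f (i - j) * of_real \<rho> ^ (i - j) * x j)))
      \<longlongrightarrow> Re (\<Sum>i\<le>N. y i * (\<Sum>j\<le>i. taylor_coeff f (i - j) * x j))) (at_left 1)"
    by simp
  have "eventually (\<lambda>\<rho>. \<rho> \<in> {0<..<1}) (at_left (1::real))"
    by (rule eventually_at_leftI[of 0]) auto
  then show "eventually (\<lambda>\<rho>. Re (\<Sum>i\<le>N. y i * (\<Sum>j\<le>i. taylor_coeff f (i - j) * of_real \<rho> ^ (i - j) * x j))
      \<le> ((\<Sum>i\<le>N. (norm (x i))\<^sup>2) + (\<Sum>i\<le>N. (norm (y i))\<^sup>2)) / 2) (at_left 1)"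
    by eventually_elim (rule Re_toeplitz_scaled_le[OF assms], auto)
qed simp

section \<open>Carlson's coefficient inequalities\<close>

lemma unimodular_rotation:
  obtains \<zeta> :: complex where "norm \<zeta> = 1" "\<zeta> * a = of_real (norm a)"
proof (cases "a = 0")
  case True
  then show ?thesis using that[of 1] by simp
next
  case False
  have "cnj a / norm a * a = norm a"
    using False complex_norm_square[of a] by (simp add: field_simps power2_eq_square)
  then show ?thesis using that[of "cnj a / norm a"] False by (simp add: norm_divide)
qed

text \<open>With \<open>N = 2n + 1\<close> the vectors \<open>x = (1, 0, \<dots>, 0, a\<^sub>n, \<dots>, a\<^sub>0)\<close> and
  \<open>y = (a\<^sub>0, \<dots>, a\<^sub>n, 0, \<dots>, 0, 1)\<close>, conjugated and rotated, make the Toeplitz form equal to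
  \<open>2S + |a\<^sub>N|\<close> while both have squared norm \<open>1 + S\<close>, where \<open>S = |a\<^sub>0|\<^sup>2 + \<dots> + |a\<^sub>n|\<^sup>2\<close>.\<close>

lemma carlson_odd:
  assumes "f \<in> bounded_class"
  shows "norm (taylor_coeff f (2 * n + 1)) \<le> 1 - (\<Sum>k\<le>n. (norm (taylor_coeff f k))\<^sup>2)"
proof -
  define a where "a = taylor_coeff f"
  define N where "N = 2 * n + 1"
  define S where "S = (\<Sum>k\<le>n. (norm (a k))\<^sup>2)"
  have Nn: "n < N" by (simp add: N_def)
  obtain \<zeta> where \<zeta>: "norm \<zeta> = 1" "\<zeta> * a N = of_real (norm (a N))"
    by (rule unimodular_rotation)
  have \<zeta>c: "\<zeta> * cnj \<zeta> = 1"
    using \<zeta>(1) complex_norm_square[of \<zeta>] by simp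
  define x where "x j = (if j = 0 then 1 else if n < j then cnj \<zeta> * cnj (a (N - j)) else 0)" for j
  define y where "y i = (if i \<le> n then cnj (a i) else if i = N then \<zeta> else 0)" for i
  \<comment> \<open>Two partitions of the index range: \<open>split\<close> follows the cases of
    \<open>y\<close>, \<open>split'\<close> those of \<open>x\<close>.\<close>
  have split: "(\<Sum>i\<le>N. g i) = (\<Sum>i\<le>n. g i) + (\<Sum>i=Suc n..<N. g i) + g N" for g :: "nat \<Rightarrow> 'b::comm_monoid_add"
  proof -
    have "{..N} = {..n} \<union> {Suc n..<N} \<union> {N}" by (auto simp: N_def)
    then show ?thesis by (subst \<open>{..N} = _\<close>, subst sum.union_disjoint; (subst sum.union_disjoint)?; auto simp: N_def)
  qed
  have split': "(\<Sum>i\<le>N. g i) = g 0 + (\<Sum>i=1..n. g i) + (\<Sum>i=Suc n..N. g i)" for g :: "nat \<Rightarrow> 'b::comm_monoid_add"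
  proof -
    have "{..N} = {0} \<union> {1..n} \<union> {Suc n..N}" by (auto simp: N_def)
    then show ?thesis by (subst \<open>{..N} = _\<close>, subst sum.union_disjoint; (subst sum.union_disjoint)?; auto simp: N_def)
  qed
  have reflect: "(\<Sum>j=Suc n..N. g (N - j)) = (\<Sum>k\<le>n. g k)" for g :: "nat \<Rightarrow> 'b::comm_monoid_add"
    by (rule sum.reindex_bij_witness[of _ "\<lambda>k. N - k" "\<lambda>k. N - k"]) (auto simp: N_def)
  \<comment> \<open>Up to index \<open>n\<close> the only nonzero entry of \<open>x\<close> is
    \<open>x 0 = 1\<close>.\<close>
  have row: "(\<Sum>j\<le>i. a (i - j) * x j) = a i" if "i \<le> n" for i
  proof -
    have "(\<Sum>j\<le>i. a (i - j) * x j) = (\<Sum>j\<in>{0}. a (i - j) * x j)"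
      using that by (intro sum.mono_neutral_right) (auto simp: x_def)
    then show ?thesis by (simp add: x_def)
  qed
  have rowN: "(\<Sum>j\<le>N. a (N - j) * x j) = a N + cnj \<zeta> * of_real S"
  proof -
    have "(\<Sum>j=Suc n..N. a (N - j) * x j) = (\<Sum>j=Suc n..N. cnj \<zeta> * of_real ((norm (a (N - j)))\<^sup>2))"
      by (intro sum.cong refl) (auto simp: x_def complex_norm_square mult_ac simp del: of_real_power)
    also have "\<dots> = cnj \<zeta> * of_real S"
      by (subst reflect) (simp add: S_def sum_distrib_left)
    finally show ?thesis
      by (simp add: split' x_def)
  qed
  have "(\<Sum>i\<le>N. y i * (\<Sum>j\<le>i. a (i - j) * x j)) = (\<Sum>i\<le>n. cnj (a i) * a i) + \<zeta> * (a N + cnj \<zeta> * of_real S)"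
    using Nn by (subst split) (simp add: y_def row rowN)
  also have "(\<Sum>i\<le>n. cnj (a i) * a i) = of_real S"
    by (simp add: S_def complex_norm_square mult_ac del: of_real_power)
  also have "of_real S + \<zeta> * (a N + cnj \<zeta> * of_real S) = of_real (2 * S + norm (a N))"
    using \<zeta> \<zeta>c by (simp add: distrib_left mult.assoc[symmetric])
  finally have Q: "Re (\<Sum>i\<le>N. y i * (\<Sum>j\<le>i. a (i - j) * x j)) = 2 * S + norm (a N)"
    by (simp only: Re_complex_of_real)
  have "(\<Sum>j=Suc n..N. (norm (x j))\<^sup>2) = (\<Sum>j=Suc n..N. (norm (a (N - j)))\<^sup>2)"
    using \<zeta> by (intro sum.cong refl) (auto simp: x_def norm_mult)
  also have "\<dots> = S"
    by (subst reflect) (simp add: S_def)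
  finally have X: "(\<Sum>i\<le>N. (norm (x i))\<^sup>2) = 1 + S"
    by (simp add: split' x_def)
  have Y: "(\<Sum>i\<le>N. (norm (y i))\<^sup>2) = S + 1"
    using \<zeta> Nn by (simp add: split y_def S_def)
  show ?thesis
    using Re_toeplitz_le[OF assms, where N=N and x=x and y=y] X Y Q
    unfolding a_def[symmetric] N_def[symmetric] S_def[symmetric] by simp
qed

text \<open>Here the middle entries of \<open>x\<close> and \<open>y\<close> are free of modulus \<open>\<gamma>\<close>, and
  \<open>\<gamma> = |a\<^sub>n| / (1 + |a\<^sub>0|)\<close> maximises the gain \<open>2\<gamma>|a\<^sub>n| - \<gamma>\<^sup>2(1 + |a\<^sub>0|)\<close>.\<close>

lemma carlson_even:
  assumes "f \<in> bounded_class" "0 < n"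
  shows "norm (taylor_coeff f (2 * n)) \<le> 1 - (\<Sum>k<n. (norm (taylor_coeff f k))\<^sup>2)
    - (norm (taylor_coeff f n))\<^sup>2 / (1 + norm (taylor_coeff f 0))"
proof -
  define a where "a = taylor_coeff f"
  define N where "N = 2 * n"
  define S where "S = (\<Sum>k<n. (norm (a k))\<^sup>2)"
  define \<gamma> where "\<gamma> = norm (a n) / (1 + norm (a 0))"
  have pos: "1 + norm (a 0) > 0" by (simp add: add_pos_nonneg)
  have Nn: "n < N" using assms by (simp add: N_def)
  obtain \<zeta> where \<zeta>: "norm \<zeta> = 1" "\<zeta> * a N = of_real (norm (a N))"
    by (rule unimodular_rotation)
  obtain \<eta> where \<eta>: "norm \<eta> = 1" "\<eta> * a n = of_real (norm (a n))"
    by (rule unimodular_rotation)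
  have \<zeta>c: "\<zeta> * cnj \<zeta> = 1"
    using \<zeta>(1) complex_norm_square[of \<zeta>] by simp
  \<comment> \<open>The phases of the middle entries are chosen so that \<open>a n\<close>
    contributes \<open>\<gamma> * norm (a n)\<close> twice: in row \<open>n\<close> against
    \<open>x 0\<close>, and in row \<open>N\<close> against \<open>x n\<close>.\<close>
  define x where "x j = (if j = 0 then 1 else if j = n then cnj \<zeta> * \<eta> * of_real \<gamma>
    else if n < j then cnj \<zeta> * cnj (a (N - j)) else 0)" for j
  define y where "y i = (if i < n then cnj (a i) else if i = n then \<eta> * of_real \<gamma>
    else if i = N then \<zeta> else 0)" for i
  have split: "(\<Sum>i\<le>N. g i) = (\<Sum>i<n. g i) + g n + (\<Sum>i=Suc n..<N. g i) + g N" for g :: "nat \<Rightarrow> 'b::comm_monoid_add"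
  proof -
    have "{..N} = insert N (insert n ({..<n} \<union> {Suc n..<N}))" using Nn by auto
    moreover have "{..<n} \<inter> {Suc n..<N} = {}" by auto
    ultimately show ?thesis using Nn by (simp add: sum.union_disjoint add_ac)
  qed
  have split': "(\<Sum>i\<le>N. g i) = g 0 + (\<Sum>i=1..<n. g i) + g n + (\<Sum>i=Suc n..N. g i)" for g :: "nat \<Rightarrow> 'b::comm_monoid_add"
  proof -
    have "{..N} = insert 0 (insert n ({1..<n} \<union> {Suc n..N}))" using Nn by auto
    moreover have "{1..<n} \<inter> {Suc n..N} = {}" by auto
    ultimately show ?thesis using assms by (simp add: sum.union_disjoint add_ac)
  qed
  have reflect: "(\<Sum>j=Suc n..N. g (N - j)) = (\<Sum>k<n. g k)" for g :: "nat \<Rightarrow> 'b::comm_monoid_add"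
    by (rule sum.reindex_bij_witness[of _ "\<lambda>k. N - k" "\<lambda>k. N - k"]) (auto simp: N_def)
  have row: "(\<Sum>j\<le>i. a (i - j) * x j) = a i" if "i < n" for i
  proof -
    have "(\<Sum>j\<le>i. a (i - j) * x j) = (\<Sum>j\<in>{0}. a (i - j) * x j)"
      using that by (intro sum.mono_neutral_right) (auto simp: x_def)
    then show ?thesis by (simp add: x_def)
  qed
  have rown: "(\<Sum>j\<le>n. a (n - j) * x j) = a n + a 0 * (cnj \<zeta> * \<eta> * of_real \<gamma>)"
  proof -
    have "(\<Sum>j\<le>n. a (n - j) * x j) = (\<Sum>j\<in>{0, n}. a (n - j) * x j)"
      by (intro sum.mono_neutral_right) (auto simp: x_def)
    then show ?thesis using assms by (simp add: x_def)
  qed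
  have rowN: "(\<Sum>j\<le>N. a (N - j) * x j) = a N + a n * (cnj \<zeta> * \<eta> * of_real \<gamma>) + cnj \<zeta> * of_real S"
  proof -
    have "(\<Sum>j=Suc n..N. a (N - j) * x j) = (\<Sum>j=Suc n..N. cnj \<zeta> * of_real ((norm (a (N - j)))\<^sup>2))"
      by (intro sum.cong refl) (auto simp: x_def complex_norm_square mult_ac simp del: of_real_power)
    also have "\<dots> = cnj \<zeta> * of_real S"
      by (subst reflect) (simp add: S_def sum_distrib_left)
    finally show ?thesis
      using assms Nn by (simp add: split' x_def) (simp add: N_def)
  qed
  have "(\<Sum>i\<le>N. y i * (\<Sum>j\<le>i. a (i - j) * x j)) = (\<Sum>i<n. cnj (a i) * a i)
      + \<eta> * of_real \<gamma> * (a n + a 0 * (cnj \<zeta> * \<eta> * of_real \<gamma>))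
      + \<zeta> * (a N + a n * (cnj \<zeta> * \<eta> * of_real \<gamma>) + cnj \<zeta> * of_real S)"
    using assms Nn by (subst split) (simp add: y_def row rown rowN)
  also have "(\<Sum>i<n. cnj (a i) * a i) = of_real S"
    by (simp add: S_def complex_norm_square mult_ac del: of_real_power)
  also have "of_real S + \<eta> * of_real \<gamma> * (a n + a 0 * (cnj \<zeta> * \<eta> * of_real \<gamma>))
      + \<zeta> * (a N + a n * (cnj \<zeta> * \<eta> * of_real \<gamma>) + cnj \<zeta> * of_real S)
      = of_real S + of_real \<gamma> * (\<eta> * a n) + of_real (\<gamma>\<^sup>2) * (\<eta>\<^sup>2 * cnj \<zeta> * a 0) + \<zeta> * a N
        + (\<zeta> * cnj \<zeta>) * (of_real \<gamma> * (\<eta> * a n) + of_real S)"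
    by (simp add: algebra_simps power2_eq_square)
  also have "\<dots> = of_real (2 * S + 2 * \<gamma> * norm (a n) + norm (a N)) + of_real (\<gamma>\<^sup>2) * (\<eta>\<^sup>2 * cnj \<zeta> * a 0)"
    by (simp add: \<zeta>c \<zeta> \<eta>)
  finally have Q: "Re (\<Sum>i\<le>N. y i * (\<Sum>j\<le>i. a (i - j) * x j)) = 2 * S + 2 * \<gamma> * norm (a n) + norm (a N)
      + \<gamma>\<^sup>2 * Re (\<eta>\<^sup>2 * cnj \<zeta> * a 0)"
    by (simp only: Re_complex_of_real plus_complex.sel times_complex.sel Im_complex_of_real mult_zero_left diff_zero)
  \<comment> \<open>The product of the two middle entries is the one term whose argument is not
    controlled. Its worst case adds \<open>norm (a 0)\<close> to the 1 coming from the norms of the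
    vectors, hence the denominator \<open>1 + norm (a 0)\<close>.\<close>
  have "- norm (a 0) \<le> Re (\<eta>\<^sup>2 * cnj \<zeta> * a 0)"
    using abs_Re_le_cmod[of "\<eta>\<^sup>2 * cnj \<zeta> * a 0"] \<zeta> \<eta> by (simp add: norm_mult norm_power)
  then have R: "- (\<gamma>\<^sup>2 * norm (a 0)) \<le> \<gamma>\<^sup>2 * Re (\<eta>\<^sup>2 * cnj \<zeta> * a 0)"
    by (metis mult_left_mono mult_minus_right zero_le_power2)
  have "(\<Sum>j=Suc n..N. (norm (x j))\<^sup>2) = (\<Sum>j=Suc n..N. (norm (a (N - j)))\<^sup>2)"
    using \<zeta> by (intro sum.cong refl) (auto simp: x_def norm_mult)
  also have "\<dots> = S"
    by (subst reflect) (simp add: S_def)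
  finally have X: "(\<Sum>i\<le>N. (norm (x i))\<^sup>2) = 1 + \<gamma>\<^sup>2 + S"
    using assms \<zeta> \<eta> by (simp add: split' x_def norm_mult power_mult_distrib)
  have Y: "(\<Sum>i\<le>N. (norm (y i))\<^sup>2) = S + \<gamma>\<^sup>2 + 1"
    using assms Nn \<zeta> \<eta> by (simp add: split y_def S_def norm_mult power_mult_distrib)
  have "2 * S + 2 * \<gamma> * norm (a n) + norm (a N) - \<gamma>\<^sup>2 * norm (a 0) \<le> 1 + \<gamma>\<^sup>2 + S"
    using Re_toeplitz_le[OF assms(1), where N=N and x=x and y=y] X Y Q R
    unfolding a_def[symmetric] by simp
  moreover have "2 * \<gamma> * norm (a n) - \<gamma>\<^sup>2 * norm (a 0) - \<gamma>\<^sup>2 = (norm (a n))\<^sup>2 / (1 + norm (a 0))"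
  proof -
    have "norm (a n) = \<gamma> * (1 + norm (a 0))" using pos by (simp add: \<gamma>_def)
    then show ?thesis using pos by (simp add: power2_eq_square field_simps)
  qed
  ultimately show ?thesis
    unfolding a_def[symmetric] N_def[symmetric] S_def[symmetric] by linarith
qed

lemma norm_taylor_coeff_0_le:
  assumes "f \<in> bounded_class"
  shows "norm (taylor_coeff f 0) \<le> 1"
  using assms by (simp add: bounded_class_def taylor_coeff_def fps_expansion_def)

text \<open>Carlson's inequalities with every square dropped except that of the constant
  coefficient.\<close>

lemma norm_taylor_coeff_le:
  assumes "f \<in> bounded_class" "0 < n"
  shows "norm (taylor_coeff f n) \<le> 1 - (norm (taylor_coeff f 0))\<^sup>2"
proof (cases "even n")
  case True
  then obtain k where k: "n = 2 * k" by (elim evenE)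
  with assms have "(norm (taylor_coeff f 0))\<^sup>2 \<le> (\<Sum>k<k. (norm (taylor_coeff f k))\<^sup>2)"
    by (intro member_le_sum) auto
  moreover have "0 \<le> (norm (taylor_coeff f k))\<^sup>2 / (1 + norm (taylor_coeff f 0))"
    by simp
  ultimately show ?thesis
    using carlson_even[OF assms(1), of k] assms(2) unfolding k by linarith
next
  case False
  then obtain k where k: "n = 2 * k + 1" by (elim oddE)
  have "(norm (taylor_coeff f 0))\<^sup>2 \<le> (\<Sum>k\<le>k. (norm (taylor_coeff f k))\<^sup>2)"
    by (intro member_le_sum) auto
  then show ?thesis
    using carlson_odd[OF assms(1), of k] k by simp
qed

section \<open>Weighted sums and the bound on \<open>B1 + A0\<close>\<close>

lemma weight_class_summable:
  assumes "\<phi> \<in> weight_class" "0 \<le> r" "r < 1"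
  shows "summable (\<lambda>n. \<phi> n r)"
proof -
  have "locally_uniformly_convergent_on {0..<1} (\<lambda>N r. \<Sum>n<N. \<phi> n r)"
    using assms by (simp add: weight_class_def)
  then obtain U where "r \<in> U" "uniformly_convergent_on (U \<inter> {0..<1}) (\<lambda>N r. \<Sum>n<N. \<phi> n r)"
    using assms unfolding locally_uniformly_convergent_on_def by (meson atLeastLessThan_iff)
  then have "convergent (\<lambda>N. \<Sum>n<N. \<phi> n r)"
    using assms by (intro uniformly_convergent_imp_convergent[of "U \<inter> {0..<1}"]) auto
  then show ?thesis
    by (simp add: summable_iff_convergent)
qed

lemma tail_sum_Suc:
  assumes "summable (\<lambda>n. \<phi> n r)"
  shows "tail_sum \<phi> N r = \<phi> N r + tail_sum \<phi> (Suc N) r"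
  unfolding tail_sum_def
  using suminf_split_head[of "\<lambda>n. \<phi> (N + n) r"] summable_ignore_initial_segment[OF assms, of N]
  by (simp add: add_ac)

lemma tail_sum_nonneg:
  assumes "summable (\<lambda>n. \<phi> n r)" "\<And>n. 0 \<le> \<phi> n r"
  shows "0 \<le> tail_sum \<phi> N r"
  unfolding tail_sum_def
  using assms summable_ignore_initial_segment[OF assms(1), of N]
  by (intro suminf_nonneg) (auto simp: add_ac)

text \<open>Carlson's inequalities bound the left-hand side coefficient by coefficient, the
  \<open>|a\<^sub>k|\<^sup>2\<close> terms they lose being exactly those collected in \<open>A0\<close>.\<close>

lemma refined_bohr_partial_sum:
  assumes "f \<in> bounded_class" and sm: "summable (\<lambda>n. \<phi> n r)" and nn: "\<And>n. 0 \<le> \<phi> n r"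
  defines "c \<equiv> \<lambda>n. norm (taylor_coeff f n)"
  shows "(\<Sum>n<2 * K. c (Suc n) * \<phi> (Suc n) r)
    + (\<Sum>k<K. (c (Suc k))\<^sup>2 * (\<phi> (2 * Suc k) r / (1 + c 0) + tail_sum \<phi> (2 * Suc k + 1) r))
    + (1 - (\<Sum>k\<le>K. (c k)\<^sup>2)) * tail_sum \<phi> (2 * K + 1) r
    \<le> (1 - (c 0)\<^sup>2) * tail_sum \<phi> 1 r"
proof (induction K)
  case 0
  then show ?case by simp
next
  case (Suc K)
  define T where "T = tail_sum \<phi> (2 * K + 3) r"
  define S where "S = (\<Sum>k\<le>K. (c k)\<^sup>2)"
  define u v where "u = \<phi> (2 * K + 1) r" and "v = \<phi> (2 * K + 2) r"
  have t: "tail_sum \<phi> (2 * K + 1) r = u + v + T"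
    using tail_sum_Suc[where \<phi>=\<phi> and r=r, OF sm, of "2 * K + 1"] tail_sum_Suc[where \<phi>=\<phi> and r=r, OF sm, of "2 * K + 2"]
    by (simp add: u_def v_def T_def eval_nat_numeral)
  have "c (2 * K + 1) \<le> 1 - S"
    using carlson_odd[OF assms(1), of K] by (simp add: c_def S_def)
  then have o: "c (2 * K + 1) * u \<le> (1 - S) * u"
    using nn by (intro mult_right_mono) (simp_all add: u_def)
  have "c (2 * K + 2) \<le> 1 - S - (c (Suc K))\<^sup>2 / (1 + c 0)"
    using carlson_even[OF assms(1), of "Suc K"] by (simp add: c_def S_def lessThan_Suc_atMost)
  then have e: "c (2 * K + 2) * v \<le> (1 - S - (c (Suc K))\<^sup>2 / (1 + c 0)) * v"
    using nn by (intro mult_right_mono) (simp_all add: v_def)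
  \<comment> \<open>The square of \<open>c (Suc K)\<close> cancels twice: its multiple of
    \<open>v\<close> against the loss in the even inequality, its multiple of \<open>T\<close>
    against the reduced remainder.\<close>
  have "(c (Suc K))\<^sup>2 * (v / (1 + c 0) + T) + c (2 * K + 1) * u + c (2 * K + 2) * v
      + (1 - S - (c (Suc K))\<^sup>2) * T \<le> (1 - S) * (u + v + T)"
    using o e by (simp add: algebra_simps)
  then show ?case
    using Suc.IH unfolding t by (simp add: S_def T_def u_def v_def eval_nat_numeral algebra_simps)
qed

text \<open>The left side of \<open>carlson_odd\<close> is nonnegative.\<close>

lemma sum_norm_sq_taylor_coeff_le:
  assumes "f \<in> bounded_class"
  shows "(\<Sum>k\<le>n. (norm (taylor_coeff f k))\<^sup>2) \<le> 1"
  using carlson_odd[OF assms, of n] norm_ge_zero[of "taylor_coeff f (2 * n + 1)"] by linarith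

text \<open>The remainder in the partial-sum estimate is nonnegative, so the partial sums of both
  nonnegative series are bounded by \<open>M\<close>; this gives convergence as well as the limit
  inequality. The last two claims serve the lower bound for the extremal functions.\<close>

lemma B1_plus_A0_le:
  assumes f: "f \<in> bounded_class" and sm: "summable (\<lambda>n. \<phi> n r)" and nn: "\<And>n. 0 \<le> \<phi> n r"
  shows "B1 f \<phi> r + A0 f \<phi> r \<le> (1 - (norm (taylor_coeff f 0))\<^sup>2) * tail_sum \<phi> 1 r"
    and "0 \<le> A0 f \<phi> r"
    and "summable (\<lambda>n. norm (taylor_coeff f (Suc n)) * \<phi> (Suc n) r)"
proof -
  define c where "c n = norm (taylor_coeff f n)" for n
  define g where "g n = c (Suc n) * \<phi> (Suc n) r" for n
  define h where "h k = (c (Suc k))\<^sup>2 * (\<phi> (2 * Suc k) r / (1 + c 0) + tail_sum \<phi> (2 * Suc k + 1) r)" for k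
  define M where "M = (1 - (c 0)\<^sup>2) * tail_sum \<phi> 1 r"
  have g0: "0 \<le> g n" and h0: "0 \<le> h n" for n
    using nn tail_sum_nonneg[where \<phi>=\<phi> and r=r, OF sm nn] by (auto simp: g_def h_def c_def)
  have bound: "(\<Sum>n<2 * K. g n) + (\<Sum>k<K. h k) \<le> M" for K
  proof -
    have "0 \<le> (1 - (\<Sum>k\<le>K. (c k)\<^sup>2)) * tail_sum \<phi> (2 * K + 1) r"
      using sum_norm_sq_taylor_coeff_le[OF f, of K] tail_sum_nonneg[where \<phi>=\<phi> and r=r, OF sm nn]
      by (intro mult_nonneg_nonneg) (auto simp: c_def)
    then show ?thesis
      using refined_bohr_partial_sum[where \<phi>=\<phi> and r=r, OF f sm nn, of K] unfolding g_def h_def M_def c_def by linarith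
  qed
  have "(\<Sum>n<K. g n) \<le> M" for K
    using bound[of K] sum_nonneg[of "{..<K}" h, OF h0] sum_mono2[of "{..<2 * K}" "{..<K}" g] g0 by force
  then have g: "summable g" using g0 by (intro summableI_nonneg_bounded) auto
  then show "summable (\<lambda>n. norm (taylor_coeff f (Suc n)) * \<phi> (Suc n) r)"
    unfolding g_def c_def .
  have "(\<Sum>n<K. h n) \<le> M" for K
    using bound[of K] sum_nonneg[of "{..<2 * K}" g, OF g0] by linarith
  then have h: "summable h" using h0 by (intro summableI_nonneg_bounded) auto
  \<comment> \<open>The limit is taken along even cut-offs, to match the two ranges in
    \<open>bound\<close>.\<close>
  have "(\<lambda>K. \<Sum>n<2 * K. g n) \<longlonglongrightarrow> suminf g"
    by (rule filterlim_compose[OF summable_LIMSEQ[OF g]]) (intro mult_nat_left_at_top; simp)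
  then have "suminf g + suminf h \<le> M"
    by (intro LIMSEQ_le_const2[OF tendsto_add[OF _ summable_LIMSEQ[OF h]]] exI[of _ 0]) (auto intro: bound)
  then show "B1 f \<phi> r + A0 f \<phi> r \<le> (1 - (norm (taylor_coeff f 0))\<^sup>2) * tail_sum \<phi> 1 r"
    unfolding B1_def A0_def g_def h_def M_def c_def by simp
  show "0 \<le> A0 f \<phi> r"
    using suminf_nonneg[OF h h0] unfolding A0_def h_def c_def by simp
qed

section \<open>The composition term and Schwarz's lemma for zeros of order m\<close>

text \<open>Termwise comparison with a geometric series by \<open>norm_taylor_coeff_le\<close>;
  \<open>s\<close> will be \<open>r ^ m\<close>.\<close>

lemma norm_diff_taylor_coeff_0_le:
  assumes f: "f \<in> bounded_class" and "norm w \<le> s" "s < 1"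
  shows "norm (f w - taylor_coeff f 0) \<le> (1 - (norm (taylor_coeff f 0))\<^sup>2) * (s / (1 - s))"
proof -
  have hol: "f holomorphic_on ball 0 1" and w: "w \<in> ball 0 1"
    using assms by (auto simp: bounded_class_def analytic_imp_holomorphic)
  have s0: "0 \<le> s" using assms norm_ge_zero order_trans by blast
  have "(\<lambda>n. taylor_coeff f n * w ^ n) sums f w"
    using holomorphic_power_series[OF hol w] by (simp add: taylor_coeff_def fps_expansion_def)
  then have S: "(\<lambda>n. taylor_coeff f (Suc n) * w ^ Suc n) sums (f w - taylor_coeff f 0)"
    using sums_Suc_iff[of "\<lambda>n. taylor_coeff f n * w ^ n"] by simp
  have G: "(\<lambda>n. (1 - (norm (taylor_coeff f 0))\<^sup>2) * (s * s ^ n)) sums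
      ((1 - (norm (taylor_coeff f 0))\<^sup>2) * (s * (1 / (1 - s))))"
    using assms s0 by (intro sums_mult geometric_sums) auto
  have le: "norm (taylor_coeff f (Suc n) * w ^ Suc n) \<le> (1 - (norm (taylor_coeff f 0))\<^sup>2) * (s * s ^ n)" for n
  proof -
    have "norm (taylor_coeff f (Suc n)) * norm w ^ Suc n \<le> (1 - (norm (taylor_coeff f 0))\<^sup>2) * s ^ Suc n"
      using assms norm_taylor_coeff_0_le[OF f] s0
      by (intro mult_mono norm_taylor_coeff_le power_mono) (auto simp: power_le_one)
    then show ?thesis by (simp only: norm_mult norm_power power_Suc)
  qed
  have "norm (\<Sum>n. taylor_coeff f (Suc n) * w ^ Suc n) \<le> (\<Sum>n. (1 - (norm (taylor_coeff f 0))\<^sup>2) * (s * s ^ n))"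
    by (rule norm_suminf_le[OF le sums_summable[OF G]])
  then show ?thesis
    using sums_unique[OF S] sums_unique[OF G] by simp
qed

text \<open>Induction peels off one zero at a time: in \<open>f z = z * h z\<close> the factor
  \<open>h\<close> is again bounded by 1, by Schwarz's lemma, and has the coefficients of
  \<open>f\<close> shifted by one.\<close>

lemma norm_le_power_of_taylor_coeff_eq_0:
  assumes "f holomorphic_on ball 0 1" "\<And>z. norm z < 1 \<Longrightarrow> norm (f z) \<le> 1"
    and "\<And>k. k < m \<Longrightarrow> taylor_coeff f k = 0" "norm z < 1"
  shows "norm (f z) \<le> norm z ^ m"
  using assms
proof (induction m arbitrary: f z)
  case 0
  then show ?case by simp
next
  case (Suc m)
  have f0: "f 0 = 0"
    using Suc.prems(3)[of 0] by (simp add: taylor_coeff_def fps_expansion_def)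
  obtain h where h: "h holomorphic_on ball 0 1" "\<And>z. norm z < 1 \<Longrightarrow> f z = z * h z" "deriv f 0 = h 0"
    using Schwarz3[OF Suc.prems(1) f0] by metis
  \<comment> \<open>The library version of Schwarz's lemma needs a strict bound, hence the factor \<open>t\<close>.\<close>
  have S: "t * norm (f z) \<le> norm z" "t * norm (deriv f 0) \<le> 1" if "0 < t" "t < 1" "norm z < 1" for t z
  proof -
    let ?g = "\<lambda>z. of_real t * f z"
    have g: "?g holomorphic_on ball 0 1" by (intro holomorphic_intros Suc.prems)
    have g1: "norm (?g z) < 1" if "norm z < 1" for z
    proof -
      have "t * norm (f z) \<le> t * 1"
        using Suc.prems(2)[OF that] \<open>0 < t\<close> by (intro mult_left_mono) auto
      also have "\<dots> < 1" using \<open>t < 1\<close> by simp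
      finally show ?thesis using \<open>0 < t\<close> by (simp add: norm_mult)
    qed
    have g0: "?g 0 = 0" by (simp add: f0)
    have "f field_differentiable (at 0)"
      using Suc.prems(1) by (intro holomorphic_on_imp_differentiable_at[of _ "ball 0 1"]) auto
    then have "deriv ?g 0 = of_real t * deriv f 0" by simp
    then show "t * norm (f z) \<le> norm z" "t * norm (deriv f 0) \<le> 1"
      using Schwarz_Lemma(1,2)[OF g g0 g1 \<open>norm z < 1\<close>] \<open>0 < t\<close> by (auto simp: norm_mult)
  qed
  have lim: "x \<le> y" if "\<And>t. 0 < t \<Longrightarrow> t < 1 \<Longrightarrow> t * x \<le> y" for x y :: real
  proof (rule tendsto_upperbound)
    have "((\<lambda>t. t * x) \<longlongrightarrow> 1 * x) (at_left 1)" by (intro tendsto_intros)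
    then show "((\<lambda>t. t * x) \<longlongrightarrow> x) (at_left 1)" by simp
    show "eventually (\<lambda>t. t * x \<le> y) (at_left 1)"
      by (rule eventually_at_leftI[of 0]) (use that in auto)
  qed simp
  \<comment> \<open>Dividing by \<open>z\<close> fails at the origin, where
    \<open>h 0 = deriv f 0\<close> is bounded by the derivative part of Schwarz's lemma.\<close>
  have h1: "norm (h z) \<le> 1" if "norm z < 1" for z
  proof (cases "z = 0")
    case True
    then show ?thesis using h(3) lim[of "norm (deriv f 0)" 1] S(2)[of _ 0] by auto
  next
    case False
    have "norm z * norm (h z) \<le> norm z * 1"
      using lim[of "norm (f z)" "norm z"] S(1)[OF _ _ that] h(2)[OF that] by (auto simp: norm_mult)
    then show ?thesis using False by simp
  qed
  have "taylor_coeff h k = taylor_coeff f (Suc k)" for k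
  proof -
    have "(\<lambda>z. z * h z) has_fps_expansion fps_X * fps_expansion h 0"
      by (intro fps_expansion_intros has_fps_expansion_disc h)
    moreover have "eventually (\<lambda>z. z * h z = f z) (nhds 0)"
      using h(2) by (intro eventually_mono[OF eventually_nhds_in_open[of "ball 0 1" "0::complex"]]) auto
    ultimately have "f has_fps_expansion fps_X * fps_expansion h 0"
      using has_fps_expansion_cong by metis
    then show ?thesis
      by (simp add: taylor_coeff_def fps_expansion_eqI)
  qed
  then have "norm (h z) \<le> norm z ^ m"
    using Suc.prems h1 by (intro Suc.IH h) auto
  then have "norm z * norm (h z) \<le> norm z * norm z ^ m"
    by (intro mult_left_mono) auto
  then show ?case
    using h(2)[OF Suc.prems(4)] by (simp add: norm_mult)
qed

lemma schwarz_class_norm_le: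
  assumes "\<omega> \<in> schwarz_class m" "norm z < 1"
  shows "norm (\<omega> z) \<le> norm z ^ m"
  using assms
  by (intro norm_le_power_of_taylor_coeff_eq_0)
    (auto simp: schwarz_class_def bounded_class_def taylor_coeff_def fps_expansion_def
      analytic_imp_holomorphic)

text \<open>With \<open>u = a\<^sup>2\<close> this places the concave function
  \<open>u powr (p / 2)\<close> below its tangent at 1. It is the weighted mean inequality for
  \<open>a\<^sup>2\<close> and 1 with weights \<open>p / 2\<close> and
  \<open>1 - p / 2\<close>.\<close>

lemma powr_le_tangent_at_1:
  fixes a p :: real
  assumes "0 \<le> a" "a \<le> 1" "0 < p" "p \<le> 2"
  shows "a powr p \<le> 1 - p / 2 * (1 - a\<^sup>2)"
proof (cases "a = 0")
  case True
  then show ?thesis using assms by simp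
next
  case False
  then have a: "0 < a" using assms by simp
  have "(a\<^sup>2) powr (p / 2) * 1 powr (1 - p / 2) \<le> p / 2 * a\<^sup>2 + (1 - p / 2) * 1"
    using assms a by (intro Youngs_inequality_0) auto
  moreover have "(a\<^sup>2) powr (p / 2) = a powr p"
    using a by (simp add: powr_powr flip: powr_numeral)
  ultimately show ?thesis by (simp add: algebra_simps)
qed

section \<open>The extremal functions\<close>

text \<open>Adding \<open>a\<close> to \<open>(u - a) / (1 - a * u)\<close> leaves
  \<open>(1 - a\<^sup>2) * u / (1 - a * u)\<close>, a geometric series.\<close>

lemma taylor_coeff_Moebius_function:
  fixes a :: real
  assumes "0 < a" "a < 1"
  shows "taylor_coeff (Moebius_function 0 a) n = (if n = 0 then - a else (1 - a\<^sup>2) * a ^ (n - 1))"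
proof -
  define c :: "nat \<Rightarrow> complex" where "c n = (if n = 0 then - a else (1 - a\<^sup>2) * a ^ (n - 1))" for n
  have "(\<lambda>n. c n * u ^ n) sums Moebius_function 0 a u" if "norm u < 1" for u
  proof -
    have "norm (a * u) = a * norm u"
      using assms by (simp add: norm_mult)
    also have "\<dots> < 1"
      using mult_strict_mono[of a 1 "norm u" 1] assms that by simp
    finally have n: "norm (a * u) < 1" .
    then have "(\<lambda>n. (1 - a\<^sup>2) * u * (a * u) ^ n) sums ((1 - a\<^sup>2) * u * (1 / (1 - a * u)))"
      by (intro sums_mult geometric_sums)
    moreover have "(1 - a\<^sup>2) * u * (a * u) ^ n = c (Suc n) * u ^ Suc n" for n
      by (simp add: c_def power_mult_distrib)
    moreover have "(1 - a\<^sup>2) * u * (1 / (1 - a * u)) = Moebius_function 0 a u - c 0 * u ^ 0"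
    proof -
      have "1 - a * u \<noteq> 0" using n by auto
      then show ?thesis
        by (simp add: c_def Moebius_function_simple field_simps power2_eq_square)
    qed
    ultimately have "(\<lambda>n. c (Suc n) * u ^ Suc n) sums (Moebius_function 0 a u - c 0 * u ^ 0)"
      by (simp only:)
    then show ?thesis
      by (simp only: sums_Suc_iff[of "\<lambda>n. c n * u ^ n"] diff_add_cancel)
  qed
  then have "eventually (\<lambda>u. (\<lambda>n. fps_nth (Abs_fps c) n * u ^ n) sums Moebius_function 0 a u) (nhds 0)"
    by (intro eventually_mono[OF eventually_nhds_in_open[of "ball 0 1" "0::complex"]]) auto
  then have "fps_expansion (Moebius_function 0 a) 0 = Abs_fps c"
    by (intro fps_expansion_eqI has_fps_expansionI)
  then show ?thesis by (simp add: taylor_coeff_def c_def)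
qed

lemma power_in_schwarz_class: "(\<lambda>z. z ^ m) \<in> schwarz_class m"
proof -
  have "(deriv ^^ k) (\<lambda>z. z ^ m) (0::complex) = fact k * fps_nth (fps_X ^ m) k" for k
    using fps_nth_fps_expansion[OF has_fps_expansion_fps_X_power, of m k] by simp
  then have "(deriv ^^ k) (\<lambda>z. z ^ m) (0::complex) = (if k = m then fact k else 0)" for k
    by simp
  then show ?thesis
    by (auto simp: schwarz_class_def bounded_class_def norm_power intro!: analytic_intros power_le_one)
qed

lemma Moebius_function_in_bounded_class:
  assumes "norm a < 1"
  shows "Moebius_function 0 a \<in> bounded_class"
  using assms Moebius_function_norm_lt_1[OF assms, of _ 0] Moebius_function_holomorphic[OF assms, of 0]
  by (auto simp: bounded_class_def analytic_on_open less_imp_le)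

section \<open>The inequality at a fixed radius\<close>

lemma bohr_sum_le:
  assumes "m \<ge> 1" "0 < p" "p \<le> 2" "\<phi> \<in> weight_class" "norm z < 1" "Psi2 m p \<phi> (norm z) \<ge> 0"
    and "f \<in> bounded_class" "\<omega> \<in> schwarz_class m"
  shows "bohr_sum p \<phi> \<omega> f z \<le> \<phi> 0 (norm z)"
proof -
  define r a where "r = norm z" and "a = norm (taylor_coeff f 0)"
  have r: "0 \<le> r" "r < 1" using assms by (auto simp: r_def)
  have nn: "0 \<le> \<phi> n r" for n using assms r by (auto simp: weight_class_def)
  note sm = weight_class_summable[OF assms(4) r]
  have a: "0 \<le> a" "a \<le> 1" using norm_taylor_coeff_0_le assms by (auto simp: a_def)
  have rm: "r ^ m < 1"
    using power_decreasing[of 1 m r] r assms(1) by simp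
  have "norm (f (\<omega> z) - taylor_coeff f 0) \<le> (1 - a\<^sup>2) * (r ^ m / (1 - r ^ m))"
    unfolding a_def r_def
    using rm assms by (intro norm_diff_taylor_coeff_0_le schwarz_class_norm_le) (auto simp: r_def)
  moreover have "B1 f \<phi> r + A0 f \<phi> r \<le> (1 - a\<^sup>2) * tail_sum \<phi> 1 r"
    unfolding a_def by (rule B1_plus_A0_le[where \<phi>=\<phi> and r=r, OF assms(7) sm nn])
  moreover have "(1 - a\<^sup>2) * (tail_sum \<phi> 1 r + r ^ m / (1 - r ^ m)) \<le> (1 - a\<^sup>2) * (p / 2 * \<phi> 0 r)"
  proof (rule mult_left_mono)
    show "tail_sum \<phi> 1 r + r ^ m / (1 - r ^ m) \<le> p / 2 * \<phi> 0 r"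
      using assms(6) unfolding Psi2_def r_def by linarith
    show "0 \<le> 1 - a\<^sup>2"
      using a by (simp add: power_le_one)
  qed
  moreover have "a powr p * \<phi> 0 r \<le> (1 - p / 2 * (1 - a\<^sup>2)) * \<phi> 0 r"
    using nn by (intro mult_right_mono powr_le_tangent_at_1 a assms) auto
  moreover have "(1 - p / 2 * (1 - a\<^sup>2)) * \<phi> 0 r = \<phi> 0 r - (1 - a\<^sup>2) * (p / 2 * \<phi> 0 r)"
    by (simp add: field_simps)
  ultimately show ?thesis
    unfolding bohr_sum_def r_def[symmetric] a_def[symmetric] distrib_left[of "1 - a\<^sup>2"] by linarith
qed

section \<open>Sharpness\<close>

text \<open>\<open>A0\<close> is dropped and \<open>B1\<close> is cut off after \<open>N\<close>
  terms, so that the later passage to the limit in \<open>a\<close> concerns a finite sum only; the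
  composition term is computed exactly.\<close>

lemma bohr_sum_Moebius_function_ge:
  fixes a :: real
  assumes "0 < a" "a < 1" "0 \<le> r" "r < 1" "\<phi> \<in> weight_class"
  shows "a powr p * \<phi> 0 r + (1 - a\<^sup>2) * ((\<Sum>n<N. a ^ n * \<phi> (Suc n) r) + r ^ m / (1 - a * r ^ m))
    \<le> bohr_sum p \<phi> (\<lambda>z. z ^ m) (Moebius_function 0 a) r"
proof -
  let ?f = "Moebius_function 0 (complex_of_real a)"
  have f: "?f \<in> bounded_class"
    using assms by (intro Moebius_function_in_bounded_class) auto
  have nn: "0 \<le> \<phi> n r" for n using assms by (auto simp: weight_class_def)
  note sm = weight_class_summable[OF assms(5,3,4)]
  have a2: "0 \<le> 1 - a\<^sup>2" using assms by (simp add: power_le_one)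
  have a2n: "norm (1 - (complex_of_real a)\<^sup>2) = 1 - a\<^sup>2"
    using a2 by (metis abs_of_nonneg norm_of_real of_real_1 of_real_diff of_real_power)
  have c0: "taylor_coeff ?f 0 = - a"
    using taylor_coeff_Moebius_function[OF assms(1,2), of 0] by simp
  have cS: "norm (taylor_coeff ?f (Suc n)) = (1 - a\<^sup>2) * a ^ n" for n
    using taylor_coeff_Moebius_function[OF assms(1,2), of "Suc n"] assms a2n
    by (simp add: norm_mult norm_power)
  have "(\<Sum>n<N. norm (taylor_coeff ?f (Suc n)) * \<phi> (Suc n) r) \<le> B1 ?f \<phi> r"
    unfolding B1_def
    by (intro sum_le_suminf B1_plus_A0_le(3)[where \<phi>=\<phi> and r=r, OF f sm nn]) (auto simp: nn)
  then have "(1 - a\<^sup>2) * (\<Sum>n<N. a ^ n * \<phi> (Suc n) r) \<le> B1 ?f \<phi> r"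
    by (simp add: cS sum_distrib_left mult_ac)
  moreover have "0 \<le> A0 ?f \<phi> r"
    by (rule B1_plus_A0_le(2)[where \<phi>=\<phi> and r=r, OF f sm nn])
  moreover have "norm (?f (of_real r ^ m) - taylor_coeff ?f 0) = (1 - a\<^sup>2) * (r ^ m / (1 - a * r ^ m))"
  proof -
    have rm: "0 \<le> r ^ m" "r ^ m \<le> 1" using assms by (auto simp: power_le_one)
    then have "a * r ^ m < 1"
      using mult_left_mono[of "r ^ m" 1 a] assms by linarith
    then have d: "1 - a * r ^ m > 0" by simp
    then have "1 - complex_of_real a * of_real r ^ m \<noteq> 0"
      by (metis less_irrefl of_real_1 of_real_diff of_real_eq_0_iff of_real_mult of_real_power)
    then have "?f (of_real r ^ m) - taylor_coeff ?f 0 = of_real ((1 - a\<^sup>2) * (r ^ m / (1 - a * r ^ m)))"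
      unfolding c0 Moebius_function_simple by (simp add: field_simps power2_eq_square)
    then show ?thesis
      using d rm a2 by (simp only: norm_of_real) (intro abs_of_nonneg mult_nonneg_nonneg divide_nonneg_pos)
  qed
  ultimately show ?thesis
    unfolding bohr_sum_def using assms by (simp add: c0 distrib_left)
qed

text \<open>After subtracting \<open>\<phi> 0 r\<close> and dividing by
  \<open>1 - a\<^sup>2\<close>, the lower bound tends, as \<open>a\<close> approaches 1, to
  \<open>- Psi2 m p \<phi> r\<close> with its tail cut off at \<open>N\<close>, which is positive
  for suitable \<open>N\<close>.\<close>

lemma bohr_sum_gt:
  fixes p r :: real
  assumes "m \<ge> 1" "\<phi> \<in> weight_class" "0 \<le> r" "r < 1" "Psi2 m p \<phi> r < 0"
  obtains f where "f \<in> bounded_class" "bohr_sum p \<phi> (\<lambda>z. z ^ m) f r > \<phi> 0 r"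
proof -
  note sm = weight_class_summable[OF assms(2-4)]
  have "(\<lambda>N. \<Sum>n<N. \<phi> (Suc n) r) \<longlonglongrightarrow> tail_sum \<phi> 1 r"
    using summable_LIMSEQ[of "\<lambda>n. \<phi> (Suc n) r"] sm
    by (simp add: tail_sum_def summable_Suc_iff[of "\<lambda>n. \<phi> n r"])
  moreover have "p / 2 * \<phi> 0 r - r ^ m / (1 - r ^ m) < tail_sum \<phi> 1 r"
    using assms(5) by (simp add: Psi2_def)
  \<comment> \<open>\<open>N\<close> is fixed before \<open>a\<close> moves, which avoids exchanging
    the limit with an infinite sum.\<close>
  ultimately have "eventually (\<lambda>N. p / 2 * \<phi> 0 r - r ^ m / (1 - r ^ m) < (\<Sum>n<N. \<phi> (Suc n) r)) sequentially"
    by (rule order_tendstoD)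
  then obtain N where N: "p / 2 * \<phi> 0 r - r ^ m / (1 - r ^ m) < (\<Sum>n<N. \<phi> (Suc n) r)"
    using eventually_sequentially by auto
  have rm: "r ^ m < 1"
    using power_decreasing[of 1 m r] assms by simp
  have pl: "((\<lambda>a::real. (1 - a powr p) / (1 - a\<^sup>2)) \<longlongrightarrow> p / 2) (at_left 1)"
    by real_asymp
  have "((\<lambda>a. (\<Sum>n<N. a ^ n * \<phi> (Suc n) r) + r ^ m / (1 - a * r ^ m) - (1 - a powr p) / (1 - a\<^sup>2) * \<phi> 0 r)
      \<longlongrightarrow> (\<Sum>n<N. 1 ^ n * \<phi> (Suc n) r) + r ^ m / (1 - 1 * r ^ m) - p / 2 * \<phi> 0 r) (at_left 1)"
    using rm by (intro tendsto_intros pl) auto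
  then have "eventually (\<lambda>a. 0 < (\<Sum>n<N. a ^ n * \<phi> (Suc n) r) + r ^ m / (1 - a * r ^ m)
      - (1 - a powr p) / (1 - a\<^sup>2) * \<phi> 0 r) (at_left 1)"
    by (rule order_tendstoD) (use N in simp)
  moreover have "eventually (\<lambda>a. a \<in> {0<..<1}) (at_left (1::real))"
    by (rule eventually_at_leftI[of 0]) auto
  ultimately have "eventually (\<lambda>a. a \<in> {0<..<1} \<and> 0 < (\<Sum>n<N. a ^ n * \<phi> (Suc n) r) + r ^ m / (1 - a * r ^ m)
      - (1 - a powr p) / (1 - a\<^sup>2) * \<phi> 0 r) (at_left 1)"
    by eventually_elim auto
  then obtain a where a: "0 < a" "a < 1" "0 < (\<Sum>n<N. a ^ n * \<phi> (Suc n) r) + r ^ m / (1 - a * r ^ m)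
      - (1 - a powr p) / (1 - a\<^sup>2) * \<phi> 0 r"
    using eventually_happens'[OF trivial_limit_at_left_real] by (metis (lifting) greaterThanLessThan_iff)
  have a2: "0 < 1 - a\<^sup>2" using a by (simp add: power_less_one_iff abs_square_less_1)
  have "0 < (1 - a\<^sup>2) * ((\<Sum>n<N. a ^ n * \<phi> (Suc n) r) + r ^ m / (1 - a * r ^ m)
      - (1 - a powr p) / (1 - a\<^sup>2) * \<phi> 0 r)"
    using a a2 by (intro mult_pos_pos)
  also have "\<dots> = (1 - a\<^sup>2) * ((\<Sum>n<N. a ^ n * \<phi> (Suc n) r) + r ^ m / (1 - a * r ^ m))
      - (1 - a powr p) * \<phi> 0 r"
    using a2 by (simp add: right_diff_distrib)
  finally have "\<phi> 0 r < bohr_sum p \<phi> (\<lambda>z. z ^ m) (Moebius_function 0 a) r"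
    using bohr_sum_Moebius_function_ge[OF a(1,2) assms(3,4,2), of p N m] by (simp add: algebra_simps)
  moreover have "Moebius_function 0 a \<in> bounded_class"
    using a by (intro Moebius_function_in_bounded_class) auto
  ultimately show ?thesis using that by blast
qed

theorem theorem2:
  fixes m :: nat and p R2 :: real and \<phi> :: "nat \<Rightarrow> real \<Rightarrow> real"
  assumes "m \<ge> 1"
    and "0 < p" and "p \<le> 2"
    and "\<phi> \<in> weight_class"
    and "minimal_positive_root (Psi2 m p \<phi>) R2"
  shows "((\<forall>r. 0 \<le> r \<and> r \<le> R2 \<longrightarrow> Psi2 m p \<phi> r \<ge> 0) \<longrightarrow>
            (\<forall>f\<in>bounded_class. \<forall>\<omega>\<in>schwarz_class m. \<forall>z\<in>unit_disc.
               norm z \<le> R2 \<longrightarrow> bohr_sum p \<phi> \<omega> f z \<le> \<phi> 0 (norm z)))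
       \<and> ((\<exists>\<epsilon>>0. R2 + \<epsilon> \<le> 1 \<and> (\<forall>r. R2 < r \<and> r < R2 + \<epsilon> \<longrightarrow> Psi2 m p \<phi> r < 0)) \<longrightarrow>
            (\<forall>R'. R2 < R' \<and> R' \<le> 1 \<longrightarrow>
               (\<exists>f\<in>bounded_class. \<exists>\<omega>\<in>schwarz_class m. \<exists>z\<in>unit_disc.
                  norm z < R' \<and> bohr_sum p \<phi> \<omega> f z > \<phi> 0 (norm z))))"
proof (intro conjI impI ballI allI)
  fix f \<omega> and z :: complex
  assume "\<forall>r. 0 \<le> r \<and> r \<le> R2 \<longrightarrow> Psi2 m p \<phi> r \<ge> 0" "f \<in> bounded_class" "\<omega> \<in> schwarz_class m"
    "z \<in> unit_disc" "norm z \<le> R2"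
  then show "bohr_sum p \<phi> \<omega> f z \<le> \<phi> 0 (norm z)"
    by (intro bohr_sum_le[OF assms(1-4)]) auto
next
  fix R'
  assume "\<exists>\<epsilon>>0. R2 + \<epsilon> \<le> 1 \<and> (\<forall>r. R2 < r \<and> r < R2 + \<epsilon> \<longrightarrow> Psi2 m p \<phi> r < 0)"
  then obtain \<epsilon> where \<epsilon>: "\<epsilon> > 0" "\<And>r. R2 < r \<Longrightarrow> r < R2 + \<epsilon> \<Longrightarrow> Psi2 m p \<phi> r < 0"
    by blast
  assume R': "R2 < R' \<and> R' \<le> 1"
  \<comment> \<open>A radius beyond \<open>R2\<close>, below \<open>R'\<close>, and still in the
    interval where \<open>Psi2\<close> is negative; the point used is \<open>z = r\<close>.\<close>
  obtain r where r: "R2 < r" "r < min R' (R2 + \<epsilon>)"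
    using dense[of R2 "min R' (R2 + \<epsilon>)"] R' \<epsilon> by auto
  have r01: "0 \<le> r" "r < 1"
    using assms(5) r R' by (auto simp: minimal_positive_root_def)
  obtain f where f: "f \<in> bounded_class" "bohr_sum p \<phi> (\<lambda>z. z ^ m) f r > \<phi> 0 r"
    using bohr_sum_gt[OF assms(1,4) r01 \<epsilon>(2)] r by auto
  show "\<exists>f\<in>bounded_class. \<exists>\<omega>\<in>schwarz_class m. \<exists>z\<in>unit_disc.
      norm z < R' \<and> bohr_sum p \<phi> \<omega> f z > \<phi> 0 (norm z)"
    using f r r01 by (intro bexI[of _ f] bexI[of _ "\<lambda>z. z ^ m"] bexI[of _ "of_real r"] power_in_schwarz_class) auto
qed

end
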